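(* Let $\mathcal{C}$ be a hereditary class of finite simple graphs and let $h:\mathcal{C}\to\mathbb{R}$ satisfy: (1) $h(G-v)\le h(G)$ for every $G\in\mathcal{C}$ and every vertex $v$ of $G$; (2) for every $G\in\mathcal{C}$ there exists a vertex $v$ whose neighbors admit an ordering $v_1,\dots,v_k$ such that, writing $G_i=G-v_1-\cdots-v_i$ ($G_0=G$) and $d_{i+1}$ for the degree of $v_{i+1}$ in $G_i$, we have $i+d_{i+1}+1\le h(G)$ for all $0\le i<k$; furthermore $h(G)\ge k+1$. Then for every $G\in\mathcal{C}$ with $n$ vertices, \[\operatorname{pd}(G)\le n\left(1-\frac{1}{h(G)}\right).\]
   Context: All graphs are finite and simple. A class $\mathcal{C}$ of graphs is hereditary if $G-x\in\mathcal{C}$ whenever $G\in\mathcal{C}$ and $x$ is a vertex of $G$ ($G-x$ being the induced subgraph on the remaining vertices). For a graph $G$ with vertex set $\{x_1,\dots,x_n\}$ and a fixed field $\mathbf{k}$, let $S=\mathbf{k}[x_1,\dots,x_n]$ and $I(G)=(x_ix_j:(x_i,x_j)\text{ an edge of }G)$ the edge ideal; $\operatorname{pd}(G)$ denotes the projective dimension of $S/I(G)$ over $S$. *)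

theory Defs
  imports Complex_Main "HOL-Library.Poly_Mapping"
begin

type_synonym 'a graph = "'a set \<times> ('a \<Rightarrow> 'a \<Rightarrow> bool)"

definition finite_simple_graph :: "'a graph \<Rightarrow> bool" where
  "finite_simple_graph G \<longleftrightarrow> finite (fst G) \<and>
     (\<forall>x y. snd G x y \<longrightarrow> x \<in> fst G \<and> y \<in> fst G \<and> x \<noteq> y \<and> snd G y x)"

definition del_vertex :: "'a graph \<Rightarrow> 'a \<Rightarrow> 'a graph" where
  "del_vertex G x = (fst G - {x},
     (\<lambda>u w. snd G u w \<and> u \<in> fst G - {x} \<and> w \<in> fst G - {x}))"

definition del_vertices :: "'a graph \<Rightarrow> 'a list \<Rightarrow> 'a graph" where
  "del_vertices G xs = foldl del_vertex G xs"

definition neighbors :: "'a graph \<Rightarrow> 'a \<Rightarrow> 'a set" where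
  "neighbors G x = {y \<in> fst G. snd G x y}"

definition degree :: "'a graph \<Rightarrow> 'a \<Rightarrow> nat" where
  "degree G x = card (neighbors G x)"

definition hereditary :: "'a graph set \<Rightarrow> bool" where
  "hereditary \<C> \<longleftrightarrow> (\<forall>G\<in>\<C>. finite_simple_graph G) \<and>
     (\<forall>G\<in>\<C>. \<forall>x\<in>fst G. del_vertex G x \<in> \<C>)"

type_synonym ('a, 'k) mpoly = "('a \<Rightarrow>\<^sub>0 nat) \<Rightarrow>\<^sub>0 'k"

definition polyring :: "'k::field itself \<Rightarrow> 'a set \<Rightarrow> ('a, 'k) mpoly set" where
  "polyring _ V = {p. \<forall>m \<in> Poly_Mapping.keys p. Poly_Mapping.keys m \<subseteq> V}"

definition Var :: "'a \<Rightarrow> ('a, 'k::field) mpoly" where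
  "Var v = Poly_Mapping.single (Poly_Mapping.single v 1) 1"

definition edge_ideal :: "'k::field itself \<Rightarrow> 'a graph \<Rightarrow> ('a, 'k) mpoly set" where
  "edge_ideal k G = {(\<Sum>e\<in>F. c e * (Var (fst e) * Var (snd e))) | F c.
      finite F \<and> F \<subseteq> {(u, w). snd G u w} \<and> (\<forall>e\<in>F. c e \<in> polyring k (fst G))}"

definition freemod :: "'k::field itself \<Rightarrow> 'a set \<Rightarrow> nat \<Rightarrow> (nat \<Rightarrow> ('a, 'k) mpoly) set" where
  "freemod k V r = {f. (\<forall>i<r. f i \<in> polyring k V) \<and> (\<forall>i\<ge>r. f i = 0)}"

definition matmap :: "(nat \<Rightarrow> nat \<Rightarrow> ('a, 'k::field) mpoly) \<Rightarrow> nat \<Rightarrow> nat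
    \<Rightarrow> (nat \<Rightarrow> ('a, 'k) mpoly) \<Rightarrow> (nat \<Rightarrow> ('a, 'k) mpoly)" where
  "matmap A m n f = (\<lambda>i. if i < m then (\<Sum>j<n. A i j * f j) else 0)"

definition is_matrix :: "'k::field itself \<Rightarrow> 'a set \<Rightarrow> nat \<Rightarrow> nat
    \<Rightarrow> (nat \<Rightarrow> nat \<Rightarrow> ('a, 'k) mpoly) \<Rightarrow> bool" where
  "is_matrix k V m n A \<longleftrightarrow> (\<forall>i<m. \<forall>j<n. A i j \<in> polyring k V)"

text \<open>A finite free resolution of length p of S/I(G):
  0 \<rightarrow> S^{r p} \<rightarrow> ... \<rightarrow> S^{r 1} \<rightarrow> S^{r 0} = S \<rightarrow> S/I(G) \<rightarrow> 0,
  where the differential d_i : S^{r i} \<rightarrow> S^{r (i-1)} is given by the matrix A i.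
  Exactness: im d_1 = I(G) (inside S = S^1), ker d_i = im d_(i+1) for 1 \<le> i < p,
  d_p injective; for p = 0 the resolution is 0 \<rightarrow> S \<rightarrow> S/I(G) \<rightarrow> 0, i.e. I(G) = 0.\<close>
definition is_free_resolution :: "'k::field itself \<Rightarrow> 'a graph \<Rightarrow> nat \<Rightarrow> (nat \<Rightarrow> nat)
    \<Rightarrow> (nat \<Rightarrow> nat \<Rightarrow> nat \<Rightarrow> ('a, 'k) mpoly) \<Rightarrow> bool" where
  "is_free_resolution k G p r A \<longleftrightarrow>
     r 0 = 1 \<and>
     (\<forall>i\<in>{1..p}. is_matrix k (fst G) (r (i - 1)) (r i) (A i)) \<and>
     (if p = 0 then edge_ideal k G = {0}
      else matmap (A 1) (r 0) (r 1) ` freemod k (fst G) (r 1)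
             = {f \<in> freemod k (fst G) 1. f 0 \<in> edge_ideal k G}) \<and>
     (\<forall>i. 1 \<le> i \<and> i < p \<longrightarrow>
        {f \<in> freemod k (fst G) (r i). matmap (A i) (r (i - 1)) (r i) f = (\<lambda>_. 0)}
          = matmap (A (i + 1)) (r i) (r (i + 1)) ` freemod k (fst G) (r (i + 1))) \<and>
     (p \<ge> 1 \<longrightarrow>
        {f \<in> freemod k (fst G) (r p). matmap (A p) (r (p - 1)) (r p) f = (\<lambda>_. 0)} = {\<lambda>_. 0})"

text \<open>pd(G) = projective dimension of S/I(G) over S = minimal length of a
  (finite) free resolution (over the polynomial ring, f.g. projectives are free).\<close>
definition pd :: "'k::field itself \<Rightarrow> 'a graph \<Rightarrow> nat" where
  "pd k G = (LEAST p. \<exists>r A. is_free_resolution k G p r A)"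

end

theory Submission
  imports Defs "HOL-Library.Function_Algebras"
begin

text \<open>Write \<open>S/I(G)\<close> for the quotient by the edge ideal and let \<open>x\<close> be a vertex. Then
  \<open>I(G) = I(G - x) + x J\<close>, where \<open>J\<close> is generated by \<open>I(G - N[x])\<close> and the variables in \<open>N(x)\<close>, and
  \<open>x\<close> is a nonzerodivisor modulo \<open>I(G - x)\<close>. The resulting short exact sequence
  \<open>0 \<rightarrow> I(G - x) \<rightarrow> J \<oplus> I(G - x) \<rightarrow> I(G) \<rightarrow> 0\<close> and the mapping cone give
  \<open>pd(G) \<le> max (pd(G - x) + 1) (pd(G - N[x]) + deg x)\<close>. Deleting the neighbours \<open>v\<^sub>1, \<dots>, v\<^sub>k\<close> of
  the vertex \<open>v\<close> one at a time leaves \<open>v\<close> isolated, so \<open>pd(G)\<close> is bounded by the numbers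
  \<open>pd(G\<^sub>i - N[v\<^sub>i\<^sub>+\<^sub>1]) + i + d\<^sub>i\<^sub>+\<^sub>1\<close> and \<open>pd(G\<^sub>k - v) + k\<close>. In each case one more vertex is removed
  than is added to the projective dimension, and at most \<open>h(G)\<close> vertices are removed in total, so
  induction on the number of vertices applies. All ideals are resolved over the polynomial ring of the
  original vertex set, which avoids any change of rings.\<close>

section \<open>Free resolutions of submodules of free modules\<close>

text \<open>These rules also fire below eta-expanded functions, which hides the group structure.\<close>
declare plus_fun_apply [simp del] zero_fun_apply [simp del] minus_apply [simp del] uminus_apply [simp del]

lemmas fun_apply = plus_fun_apply zero_fun_apply minus_apply uminus_apply

section \<open>Vectors, linear combinations and submodules over a subring\<close>

definition smul :: "'r::comm_ring_1 \<Rightarrow> (nat \<Rightarrow> 'r) \<Rightarrow> nat \<Rightarrow> 'r" where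
  "smul c f = (\<lambda>i. c * f i)"

definition lincomb :: "nat \<Rightarrow> (nat \<Rightarrow> nat \<Rightarrow> 'r::comm_ring_1) \<Rightarrow> (nat \<Rightarrow> 'r) \<Rightarrow> nat \<Rightarrow> 'r" where
  "lincomb r g f = (\<Sum>j<r. smul (f j) (g j))"

text \<open>The ring is a subset of a type because the polynomials in the variables \<open>V\<close>
  form only part of the type of all polynomials.\<close>

definition subring :: "'r::comm_ring_1 set \<Rightarrow> bool" where
  "subring S \<longleftrightarrow> 1 \<in> S \<and> (\<forall>a\<in>S. \<forall>b\<in>S. a - b \<in> S \<and> a * b \<in> S)"

text \<open>Vectors of all ranks share one type and are padded by zeros, so a chain of free modules
  of varying ranks stays within that type.\<close>

definition free_mod :: "'r::comm_ring_1 set \<Rightarrow> nat \<Rightarrow> (nat \<Rightarrow> 'r) set" where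
  "free_mod S r = {f. (\<forall>i<r. f i \<in> S) \<and> (\<forall>i\<ge>r. f i = 0)}"

definition submod :: "'r::comm_ring_1 set \<Rightarrow> (nat \<Rightarrow> 'r) set \<Rightarrow> bool" where
  "submod S M \<longleftrightarrow> 0 \<in> M \<and> (\<forall>f\<in>M. \<forall>g\<in>M. f + g \<in> M) \<and> (\<forall>c\<in>S. \<forall>f\<in>M. smul c f \<in> M)"

definition lin :: "'r::comm_ring_1 set \<Rightarrow> (nat \<Rightarrow> 'r) set \<Rightarrow> ((nat \<Rightarrow> 'r) \<Rightarrow> nat \<Rightarrow> 'r) \<Rightarrow> bool" where
  "lin S M q \<longleftrightarrow> (\<forall>f\<in>M. \<forall>g\<in>M. q (f + g) = q f + q g) \<and> (\<forall>c\<in>S. \<forall>f\<in>M. q (smul c f) = smul c (q f))"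

text \<open>For an ideal \<open>I\<close> of \<open>S\<close>, \<open>resolvable S n I\<close> says that \<open>S/I\<close> has projective dimension at most \<open>n\<close>:
  the index counts the free modules in a resolution of \<open>I\<close> itself.\<close>

primrec resolvable :: "'r::comm_ring_1 set \<Rightarrow> nat \<Rightarrow> (nat \<Rightarrow> 'r) set \<Rightarrow> bool" where
  "resolvable S 0 M \<longleftrightarrow> M = {0}"
| "resolvable S (Suc n) M \<longleftrightarrow>
     (\<exists>r g. lincomb r g ` free_mod S r = M \<and> resolvable S n {f \<in> free_mod S r. lincomb r g f = 0})"

lemma subringD:
  assumes "subring S"
  shows "1 \<in> S" "0 \<in> S" "a \<in> S \<Longrightarrow> b \<in> S \<Longrightarrow> a + b \<in> S" "a \<in> S \<Longrightarrow> - a \<in> S"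
    "a \<in> S \<Longrightarrow> b \<in> S \<Longrightarrow> a - b \<in> S" "a \<in> S \<Longrightarrow> b \<in> S \<Longrightarrow> a * b \<in> S"
proof -
  show 1: "1 \<in> S" and d: "a \<in> S \<Longrightarrow> b \<in> S \<Longrightarrow> a - b \<in> S" and "a \<in> S \<Longrightarrow> b \<in> S \<Longrightarrow> a * b \<in> S" for a b
    using assms by (auto simp: subring_def)
  from d[OF 1 1] show 0: "0 \<in> S" by simp
  from d[OF 0] show n: "a \<in> S \<Longrightarrow> - a \<in> S" for a by force
  from d[OF _ n] show "a \<in> S \<Longrightarrow> b \<in> S \<Longrightarrow> a + b \<in> S" for a b by force
qed

lemma smul_simps [simp]:
  "smul c (f + g) = smul c f + smul c g" "smul (a + b) f = smul a f + smul b f"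
  "smul a (smul b f) = smul (a * b) f" "smul 1 f = f" "smul 0 f = 0" "smul c 0 = 0" "smul (- 1) f = - f"
  "smul c (- f) = - smul c f" "smul (- c) f = - smul c f"
  by (auto simp: smul_def fun_eq_iff fun_apply algebra_simps)

lemma smul_sum: "smul c (\<Sum>j\<in>J. f j) = (\<Sum>j\<in>J. smul c (f j))"
  using sum_comp_morphism[of "smul c" f J] by (simp add: o_def)

lemma lincomb_add: "lincomb r g (f + f') = lincomb r g f + lincomb r g f'"
  by (simp add: lincomb_def fun_apply sum.distrib)

lemma lincomb_smul: "lincomb r g (smul c f) = smul c (lincomb r g f)"
  by (simp add: lincomb_def smul_sum) (simp add: smul_def)

lemma lincomb_0 [simp]: "lincomb r g 0 = 0"
  by (simp add: lincomb_def fun_apply)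

lemma submod_free_mod: "subring S \<Longrightarrow> submod S (free_mod S r)"
  by (auto simp: submod_def free_mod_def smul_def fun_apply dest: subringD)

lemma submodD:
  assumes "submod S M"
  shows "0 \<in> M" "f \<in> M \<Longrightarrow> g \<in> M \<Longrightarrow> f + g \<in> M" "c \<in> S \<Longrightarrow> f \<in> M \<Longrightarrow> smul c f \<in> M"
  using assms by (auto simp: submod_def)

lemma submod_uminus: "subring S \<Longrightarrow> submod S M \<Longrightarrow> f \<in> M \<Longrightarrow> - f \<in> M"
  using submodD(3)[of S M "- 1" f] by (simp add: subringD)

lemma submod_diff: "subring S \<Longrightarrow> submod S M \<Longrightarrow> f \<in> M \<Longrightarrow> g \<in> M \<Longrightarrow> f - g \<in> M"
  using submodD(2)[of S M f "- g"] by (simp add: submod_uminus)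

lemma linD:
  assumes "lin S M q"
  shows "f \<in> M \<Longrightarrow> g \<in> M \<Longrightarrow> q (f + g) = q f + q g" "c \<in> S \<Longrightarrow> f \<in> M \<Longrightarrow> q (smul c f) = smul c (q f)"
  using assms by (auto simp: lin_def)

lemma lin_0: "lin S M q \<Longrightarrow> submod S M \<Longrightarrow> q 0 = 0"
  using linD(1)[of S M q 0 0] by (auto simp: submodD)

lemma lin_uminus: "subring S \<Longrightarrow> lin S M q \<Longrightarrow> f \<in> M \<Longrightarrow> q (- f) = - q f"
  using linD(2)[of S M q "- 1" f] by (simp add: subringD)

lemma lin_diff:
  assumes "subring S" "submod S M" "lin S M q" "f \<in> M" "g \<in> M"
  shows "q (f - g) = q f - q g"
  using linD(1)[OF assms(3,4) submod_uminus[OF assms(1,2,5)]] lin_uminus[OF assms(1,3,5)]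
  unfolding diff_conv_add_uminus by metis

lemma submod_ker:
  assumes "submod S M" "lin S M q"
  shows "submod S {f \<in> M. q f = 0}"
  using assms by (auto simp: submod_def lin_0) (auto simp: lin_def)

lemma lin_lincomb: "lin S M (lincomb r g)"
  by (simp add: lin_def lincomb_add lincomb_smul)

lemma lincomb_in:
  assumes "submod S M" "\<And>j. j < r \<Longrightarrow> g j \<in> M" "f \<in> free_mod S r"
  shows "lincomb r g f \<in> M"
proof -
  have "J \<subseteq> {..<r} \<Longrightarrow> (\<Sum>j\<in>J. smul (f j) (g j)) \<in> M" for J
    by (induction J rule: infinite_finite_induct)
      (use assms in \<open>auto intro!: submodD(2)[OF assms(1)] submodD(3)[OF assms(1)] simp: submodD(1) free_mod_def\<close>)
  then show ?thesis by (simp add: lincomb_def)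
qed

lemma lin_of_lincomb:
  assumes "submod S M" "lin S M q" "\<And>j. j < r \<Longrightarrow> g j \<in> M" "f \<in> free_mod S r"
  shows "q (lincomb r g f) = lincomb r (\<lambda>j. q (g j)) f"
proof -
  have "J \<subseteq> {..<r} \<Longrightarrow> (\<Sum>j\<in>J. smul (f j) (g j)) \<in> M \<and>
      q (\<Sum>j\<in>J. smul (f j) (g j)) = (\<Sum>j\<in>J. smul (f j) (q (g j)))" for J
  proof (induction J rule: infinite_finite_induct)
    case (insert x F)
    then show ?case using assms
      by (auto simp: free_mod_def linD submodD)
  qed (use assms in \<open>auto simp: lin_0 submodD\<close>)
  then show ?thesis by (auto simp: lincomb_def)
qed

lemma lincomb_unit:
  assumes "subring S" "j < r"
  shows "(\<lambda>i. if i = j then 1 else 0) \<in> free_mod S r" "lincomb r g (\<lambda>i. if i = j then 1 else 0) = g j"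
proof -
  show "(\<lambda>i. if i = j then 1 else 0) \<in> free_mod S r"
    using assms by (auto simp: free_mod_def subringD)
  have "lincomb r g (\<lambda>i. if i = j then 1 else 0) = (\<Sum>i<r. if i = j then g j else 0)"
    unfolding lincomb_def by (rule sum.cong) auto
  then show "lincomb r g (\<lambda>i. if i = j then 1 else 0) = g j"
    using assms by simp
qed

lemma generator_in_image:
  assumes "subring S" "lincomb r g ` free_mod S r = M" "j < r"
  shows "g j \<in> M"
  using lincomb_unit(1)[OF assms(1,3)] lincomb_unit(2)[OF assms(1,3), of g] assms(2) by (metis imageI)

section \<open>Horseshoe lemma and mapping cone\<close>

lemma free_mod_split:
  assumes "f \<in> free_mod S (r + s)" "subring S"
  shows "(\<lambda>i. if i < r then f i else 0) \<in> free_mod S r" "(\<lambda>i. f (i + r)) \<in> free_mod S s"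
  using assms by (auto simp: free_mod_def)

lemma free_mod_append:
  assumes "f \<in> free_mod S r" "f' \<in> free_mod S s"
  shows "(\<lambda>i. if i < r then f i else f' (i - r)) \<in> free_mod S (r + s)"
  using assms by (auto simp: free_mod_def)

lemma lincomb_split:
  "lincomb (r + s) (\<lambda>j. if j < r then g j else h (j - r)) f =
     lincomb r g (\<lambda>i. if i < r then f i else 0) + lincomb s h (\<lambda>i. f (i + r))"
proof -
  have "lincomb (r + s) (\<lambda>j. if j < r then g j else h (j - r)) f =
     (\<Sum>j<r. smul (f j) (g j)) + (\<Sum>j=r..<r+s. smul (f j) (h (j - r)))"
    unfolding lincomb_def
    unfolding atLeast0LessThan[symmetric]
    by (subst sum.atLeastLessThan_concat[of 0 r "r + s", symmetric]) (auto simp del: sum.atLeastLessThan_concat)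
  also have "(\<Sum>j=r..<r+s. smul (f j) (h (j - r))) = (\<Sum>j<s. smul (f (j + r)) (h j))"
    using sum.shift_bounds_nat_ivl[of "\<lambda>j. smul (f j) (h (j - r))" 0 r s]
    by (simp add: add.commute atLeast0LessThan)
  finally show ?thesis unfolding lincomb_def by simp
qed

text \<open>For an exact sequence \<open>A -> B -> C\<close>, images of generators of
  \<open>A\<close> and lifts of generators of \<open>C\<close> generate \<open>B\<close>, and the
  three kernels form an exact sequence again. If \<open>A\<close> and \<open>C\<close> vanish, so
  does \<open>B\<close>.\<close>

lemma resolvable_horseshoe:
  assumes S: "subring S"
  shows "submod S A \<Longrightarrow> submod S B \<Longrightarrow> submod S C \<Longrightarrow> lin S A i \<Longrightarrow> inj_on i A \<Longrightarrow>
     lin S B q \<Longrightarrow> q ` B = C \<Longrightarrow> i ` A = {b \<in> B. q b = 0} \<Longrightarrow>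
     resolvable S n A \<Longrightarrow> resolvable S n C \<Longrightarrow> resolvable S n B"
proof (induction n arbitrary: A B C i q)
  case 0
  then have A: "A = {0}" and C: "C = {0}" by simp_all
  have "i ` A = {0}" using lin_0[OF 0(4,1)] by (simp add: A)
  moreover have "q b = 0" if "b \<in> B" for b using 0(7) that C by blast
  ultimately show ?case using 0(8) by auto
next
  case (Suc n)
  note A = Suc.prems(1) and B = Suc.prems(2) and C = Suc.prems(3) and i = Suc.prems(4) and inj = Suc.prems(5)
    and q = Suc.prems(6) and qB = Suc.prems(7) and ex = Suc.prems(8)
  from Suc.prems(9) obtain r g where g: "lincomb r g ` free_mod S r = A"
    and Kg: "resolvable S n {f \<in> free_mod S r. lincomb r g f = 0}" by auto
  from Suc.prems(10) obtain s h where h: "lincomb s h ` free_mod S s = C"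
    and Kh: "resolvable S n {f \<in> free_mod S s. lincomb s h f = 0}" by auto
  have "\<exists>b. b \<in> B \<and> q b = h j" if "j < s" for j
    using generator_in_image[OF S h that] qB by auto
  then obtain b where b: "\<And>j. j < s \<Longrightarrow> b j \<in> B" "\<And>j. j < s \<Longrightarrow> q (b j) = h j" by metis
  have gA: "g j \<in> A" if "j < r" for j using generator_in_image[OF S g that] .
  have iB: "i a \<in> B" "q (i a) = 0" if "a \<in> A" for a using ex that by auto
  \<comment> \<open>Generators of \<open>A\<close>, pushed into \<open>B\<close>, come first,
    followed by the lifts \<open>b\<close>. The maps \<open>?t\<close> and \<open>?s\<close> project
    a coefficient vector onto the two blocks, and \<open>?a\<close> glues the blocks
    together.\<close>
  let ?g = "\<lambda>j. if j < r then i (g j) else b (j - r)"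
  let ?t = "\<lambda>f::nat \<Rightarrow> 'a. (\<lambda>i. if i < r then f i else 0)" and ?s = "\<lambda>f::nat \<Rightarrow> 'a. (\<lambda>i. f (i + r))"
  let ?a = "\<lambda>f f' :: nat \<Rightarrow> 'a. (\<lambda>i. if i < r then f i else f' (i - r))"
  have split: "lincomb (r + s) ?g f = i (lincomb r g (?t f)) + lincomb s b (?s f)" if "f \<in> free_mod S (r + s)" for f
    using lin_of_lincomb[of S A i r g, OF A i gA free_mod_split(1)[OF that S]]
      lincomb_split[of r s "\<lambda>j. i (g j)" b f] by simp
  have bq: "lincomb s b f \<in> B" "q (lincomb s b f) = lincomb s h f" if "f \<in> free_mod S s" for f
  proof -
    show "lincomb s b f \<in> B" using lincomb_in[of S B s b, OF B b(1) that] .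
    show "q (lincomb s b f) = lincomb s h f"
      using lin_of_lincomb[of S B q s b, OF B q b(1) that] b(2) by (simp add: lincomb_def)
  qed
  have giB: "i (lincomb r g f) \<in> B" "q (i (lincomb r g f)) = 0" if "f \<in> free_mod S r" for f
    using iB g that by auto
  have ta: "?t (?a f f') = f" "?s (?a f f') = f'" if "f \<in> free_mod S r" for f f'
    using that by (auto simp: free_mod_def fun_eq_iff)
  let ?K = "{f \<in> free_mod S (r + s). lincomb (r + s) ?g f = 0}"
  have im: "lincomb (r + s) ?g ` free_mod S (r + s) = B"
  proof (intro equalityI subsetI)
    fix x assume "x \<in> lincomb (r + s) ?g ` free_mod S (r + s)"
    then obtain f where f: "f \<in> free_mod S (r + s)" "x = lincomb (r + s) ?g f" by auto
    show "x \<in> B" unfolding f(2) split[OF f(1)]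
      using f(1) by (intro submodD(2)[OF B] giB bq free_mod_split S)
  next
    fix x assume x: "x \<in> B"
    with qB h have "q x \<in> lincomb s h ` free_mod S s" by auto
    then obtain f' where f': "f' \<in> free_mod S s" "q x = lincomb s h f'" by auto
    then have "x - lincomb s b f' \<in> {b \<in> B. q b = 0}"
      using x by (simp add: submod_diff[OF S B] lin_diff[OF S B q] bq)
    then obtain a where a: "a \<in> A" "x - lincomb s b f' = i a" using ex by auto
    then obtain f where f: "f \<in> free_mod S r" "a = lincomb r g f" using g by auto
    have "lincomb (r + s) ?g (?a f f') = x"
      using split[OF free_mod_append[OF f(1) f'(1)]] a f by (simp add: ta diff_eq_eq)
    then show "x \<in> lincomb (r + s) ?g ` free_mod S (r + s)"
      using free_mod_append[OF f(1) f'(1)] by blast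
  qed
  \<comment> \<open>The kernels are linked by the inclusion and by \<open>?s\<close>, so the
    induction hypothesis applies to them.\<close>
  have "resolvable S n ?K"
  proof (rule Suc.IH[OF _ _ _ _ _ _ _ _ Kg Kh])
    show "submod S {f \<in> free_mod S r. lincomb r g f = 0}" "submod S {f \<in> free_mod S s. lincomb s h f = 0}" "submod S ?K"
      by (intro submod_ker submod_free_mod S lin_lincomb)+
    show "lin S {f \<in> free_mod S r. lincomb r g f = 0} (\<lambda>f. f)" "inj_on (\<lambda>f. f) {f \<in> free_mod S r. lincomb r g f = 0}"
      by (auto simp: lin_def)
    show "lin S ?K ?s" by (auto simp: lin_def smul_def fun_eq_iff fun_apply)
    show "?s ` ?K = {f \<in> free_mod S s. lincomb s h f = 0}"
    proof (intro equalityI subsetI)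
      fix x assume "x \<in> ?s ` ?K"
      then obtain f where f: "f \<in> free_mod S (r + s)" "lincomb (r + s) ?g f = 0" "x = ?s f" by auto
      have "0 = q (lincomb (r + s) ?g f)" using f(2) lin_0[OF q B] by simp
      also have "\<dots> = lincomb s h (?s f)"
        using split[OF f(1)] f(1)
        by (simp add: linD(1)[OF q] giB bq free_mod_split[OF f(1) S])
      finally show "x \<in> {f \<in> free_mod S s. lincomb s h f = 0}" using f free_mod_split[OF f(1) S] by simp
    next
      \<comment> \<open>A relation \<open>f'\<close> among the generators of \<open>C\<close> holds
        among their lifts only up to some \<open>i a\<close>; coefficients for \<open>- a\<close> in
        the first block cancel it.\<close>
      fix f' assume "f' \<in> {f \<in> free_mod S s. lincomb s h f = 0}"
      then have f': "f' \<in> free_mod S s" "lincomb s h f' = 0" by auto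
      then have "lincomb s b f' \<in> {b \<in> B. q b = 0}" by (simp add: bq)
      then obtain a where a: "a \<in> A" "lincomb s b f' = i a" using ex by auto
      then have "- a \<in> A" "i (- a) = - i a" by (simp_all add: submod_uminus[OF S A] lin_uminus[OF S i])
      then obtain f where f: "f \<in> free_mod S r" "- a = lincomb r g f" using g by auto
      have "lincomb (r + s) ?g (?a f f') = 0"
        using split[OF free_mod_append[OF f(1) f'(1)]] a f(2)[symmetric] \<open>i (- a) = - i a\<close>
        by (simp add: ta[OF f(1)])
      then have "?a f f' \<in> ?K" using free_mod_append[OF f(1) f'(1)] by simp
      then show "f' \<in> ?s ` ?K" by (rule image_eqI[rotated]) (rule ta(2)[OF f(1), symmetric])
    qed
    show "(\<lambda>f. f) ` {f \<in> free_mod S r. lincomb r g f = 0} = {f \<in> ?K. ?s f = 0}"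
    proof (intro equalityI subsetI)
      fix f assume "f \<in> (\<lambda>f. f) ` {f \<in> free_mod S r. lincomb r g f = 0}"
      then have f: "f \<in> free_mod S r" "lincomb r g f = 0" by auto
      have f1: "f \<in> free_mod S (r + s)"
        unfolding free_mod_def
      proof (intro CollectI conjI allI impI)
        fix i show "f i \<in> S" using f(1) subringD(2)[OF S] by (cases "i < r") (auto simp: free_mod_def)
      qed (use f in \<open>auto simp: free_mod_def\<close>)
      have f2: "?s f = 0" "?t f = f" using f(1) by (auto simp: free_mod_def fun_eq_iff fun_apply)
      show "f \<in> {f \<in> ?K. ?s f = 0}"
        using split[OF f1] f f1 by (simp add: f2 lin_0[OF i A])
    next
      fix f assume "f \<in> {f \<in> ?K. ?s f = 0}"
      then have f: "f \<in> free_mod S (r + s)" "lincomb (r + s) ?g f = 0" and s0: "?s f = 0" by auto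
      have "?t f = f"
      proof
        fix j show "?t f j = f j" using fun_cong[OF s0, of "j - r"] by (cases "j < r") (simp_all add: fun_apply)
      qed
      then have tf: "f \<in> free_mod S r" using free_mod_split(1)[OF f(1) S] by simp
      have "i (lincomb r g f) = 0" using split[OF f(1)] f(2) s0 \<open>?t f = f\<close> by simp
      then have "i (lincomb r g f) = i 0" by (simp add: lin_0[OF i A])
      moreover have "lincomb r g f \<in> A" using g tf by auto
      ultimately have "lincomb r g f = 0" using inj submodD(1)[OF A] by (auto dest: inj_onD)
      then show "f \<in> (\<lambda>f. f) ` {f \<in> free_mod S r. lincomb r g f = 0}" using tf by simp
    qed
  qed
  then show ?case using im by auto
qed

text \<open>Generators of \<open>B\<close> also generate \<open>C\<close>. Their relations in
  \<open>C\<close> are an extension of \<open>A\<close> by their relations in \<open>B\<close>, so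
  the horseshoe lemma bounds the new kernel. Thus \<open>A\<close> enters with an index one less
  than that of \<open>B\<close>.\<close>

lemma resolvable_cone:
  assumes S: "subring S" and A: "submod S A" and B: "submod S B" and i: "lin S A i" "inj_on i A"
    and q: "lin S B q" "q ` B = C" and ex: "i ` A = {b \<in> B. q b = 0}"
    and "resolvable S n A" "resolvable S (Suc n) B"
  shows "resolvable S (Suc n) C"
proof -
  from \<open>resolvable S (Suc n) B\<close> obtain r g where g: "lincomb r g ` free_mod S r = B"
    and Kg: "resolvable S n {f \<in> free_mod S r. lincomb r g f = 0}" by auto
  have gB: "g j \<in> B" if "j < r" for j using generator_in_image[OF S g that] .
  let ?h = "\<lambda>j. q (g j)"
  have h: "lincomb r ?h f = q (lincomb r g f)" if "f \<in> free_mod S r" for f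
    using lin_of_lincomb[of S B q r g, OF B q(1) gB that] by simp
  have im: "lincomb r ?h ` free_mod S r = C"
    unfolding q(2)[symmetric] g[symmetric] by (auto simp: h image_iff)
  let ?L = "{f \<in> free_mod S r. lincomb r ?h f = 0}"
  \<comment> \<open>A relation in \<open>C\<close> yields an element of \<open>B\<close> killed by
    \<open>q\<close>, hence in the image of \<open>i\<close>; \<open>j\<close> takes its preimage,
    which is unique by injectivity.\<close>
  define j where "j f = inv_into A i (lincomb r g f)" for f
  have j: "j f \<in> A" "i (j f) = lincomb r g f" if "f \<in> ?L" for f
  proof -
    have "lincomb r g f \<in> i ` A" using that g by (auto simp: ex h)
    then show "j f \<in> A" "i (j f) = lincomb r g f" by (auto simp: j_def inv_into_into f_inv_into_f)
  qed
  have j_eq: "j f = a" if "f \<in> ?L" "a \<in> A" "i a = lincomb r g f" for f a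
    using j[OF that(1)] that(2,3) i(2) by (metis inj_onD)
  have L: "submod S ?L" by (intro submod_ker submod_free_mod S lin_lincomb)
  have "resolvable S n ?L"
  proof (rule resolvable_horseshoe[OF S _ L A, of _ "\<lambda>f. f" j])
    show "submod S {f \<in> free_mod S r. lincomb r g f = 0}" by (intro submod_ker submod_free_mod S lin_lincomb)
    show "lin S ?L j"
      unfolding lin_def
      by (intro conjI ballI j_eq submodD[OF L] submodD[OF A] j)
        (simp_all add: linD[OF i(1)] j lincomb_add lincomb_smul)
    show "j ` ?L = A"
    proof (intro equalityI subsetI)
      fix a assume a: "a \<in> A"
      then have "i a \<in> B" "q (i a) = 0" using ex by auto
      then obtain f where f: "f \<in> free_mod S r" "i a = lincomb r g f" using g by auto
      then have "f \<in> ?L" using \<open>q (i a) = 0\<close> by (simp add: h)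
      with j_eq[OF this a f(2)] show "a \<in> j ` ?L" by blast
    qed (use j in auto)
    show "(\<lambda>f. f) ` {f \<in> free_mod S r. lincomb r g f = 0} = {f \<in> ?L. j f = 0}"
    proof (intro equalityI subsetI)
      fix f assume "f \<in> (\<lambda>f. f) ` {f \<in> free_mod S r. lincomb r g f = 0}"
      then have f: "f \<in> free_mod S r" "lincomb r g f = 0" by auto
      then have "f \<in> ?L" by (simp add: h lin_0[OF q(1) B])
      with f show "f \<in> {f \<in> ?L. j f = 0}"
        by (auto intro!: j_eq submodD(1)[OF A] simp: lin_0[OF i(1) A])
    next
      fix f assume f: "f \<in> {f \<in> ?L. j f = 0}"
      then have "lincomb r g f = i 0" using j(2)[of f] by auto
      then show "f \<in> (\<lambda>f. f) ` {f \<in> free_mod S r. lincomb r g f = 0}"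
        using f by (simp add: lin_0[OF i(1) A])
    qed
  qed (use Kg assms(9) in \<open>auto simp: lin_def\<close>)
  with im show ?thesis by auto
qed

lemma free_mod_0: "free_mod S 0 = {0}"
  by (auto simp: free_mod_def fun_eq_iff fun_apply)

text \<open>A resolution is lengthened by a free module of rank zero at its far end.\<close>

lemma resolvable_Suc: "resolvable S n M \<Longrightarrow> resolvable S (Suc n) M"
proof (induction n arbitrary: M)
  case 0
  have "lincomb 0 (\<lambda>_. 0) ` free_mod S 0 = M" "{f \<in> free_mod S 0. lincomb 0 (\<lambda>_. 0) f = 0} = {0}"
    using 0 by (auto simp: free_mod_0)
  then show ?case unfolding resolvable.simps by blast
next
  case (Suc n)
  then obtain r g where "lincomb r g ` free_mod S r = M" "resolvable S n {f \<in> free_mod S r. lincomb r g f = 0}"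
    by auto
  with Suc.IH show ?case unfolding resolvable.simps(2)[of S "Suc n"] by blast
qed

lemma resolvable_mono: "m \<le> n \<Longrightarrow> resolvable S m M \<Longrightarrow> resolvable S n M"
  by (induction n rule: dec_induct) (auto intro: resolvable_Suc simp del: resolvable.simps)

section \<open>Ideals as submodules of rank one, and the ideal \<open>I + zJ\<close>\<close>

definition ideal_module :: "'r::comm_ring_1 set \<Rightarrow> (nat \<Rightarrow> 'r) set" where
  "ideal_module I = {f. f 0 \<in> I \<and> (\<forall>i\<ge>1. f i = 0)}"

definition ideal_in :: "'r::comm_ring_1 set \<Rightarrow> 'r set \<Rightarrow> bool" where
  "ideal_in S I \<longleftrightarrow> I \<subseteq> S \<and> 0 \<in> I \<and> (\<forall>a\<in>I. \<forall>b\<in>I. a + b \<in> I) \<and> (\<forall>c\<in>S. \<forall>a\<in>I. c * a \<in> I)"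

lemma submod_ideal_module: "ideal_in S I \<Longrightarrow> submod S (ideal_module I)"
  by (auto simp: ideal_in_def submod_def ideal_module_def smul_def fun_apply)

text \<open>The whole ring is free of rank one on the generator 1, so its first kernel is already
  zero.\<close>

lemma resolvable_unit_ideal:
  assumes S: "subring S"
  shows "resolvable S (Suc n) (ideal_module S)"
proof -
  let ?g = "\<lambda>(j::nat) i. if i = (0::nat) then (1::'a) else 0"
  have id: "lincomb 1 ?g f = f" if "f \<in> free_mod S 1" for f
    using that by (auto simp: lincomb_def smul_def free_mod_def fun_eq_iff)
  have "free_mod S 1 = ideal_module S" by (auto simp: free_mod_def ideal_module_def)
  moreover have "lincomb 1 ?g ` free_mod S 1 = (\<lambda>f. f) ` free_mod S 1" by (rule image_cong) (simp_all only: id)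
  ultimately have "lincomb 1 ?g ` free_mod S 1 = ideal_module S" by (simp only: image_ident)
  moreover have "{f \<in> free_mod S 1. lincomb 1 ?g f = 0} = {0}"
    using submodD(1)[OF submod_free_mod[OF S]] id by force
  ultimately have "resolvable S (Suc 0) (ideal_module S)" unfolding resolvable.simps by blast
  then show ?thesis by (rule resolvable_mono[rotated]) simp
qed

text \<open>The sequence behind this is \<open>0 \<rightarrow> I \<rightarrow> J \<oplus> I \<rightarrow> I + zJ \<rightarrow> 0\<close> with maps
  \<open>a \<mapsto> (a, - z a)\<close> and \<open>(a, b) \<mapsto> z a + b\<close>.\<close>

lemma resolvable_add_mult:
  assumes S: "subring S" and I: "ideal_in S I" and J: "ideal_in S J" and IJ: "I \<subseteq> J" and z: "z \<in> S"
    and nzd: "\<And>a. a \<in> S \<Longrightarrow> z * a \<in> I \<Longrightarrow> a \<in> I"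
    and PI: "resolvable S n (ideal_module I)" and PJ: "resolvable S (Suc n) (ideal_module J)"
  shows "resolvable S (Suc n) (ideal_module {z * a + b | a b. a \<in> J \<and> b \<in> I})"
proof -
  let ?B = "{f :: nat \<Rightarrow> 'a. f 0 \<in> J \<and> f 1 \<in> I \<and> (\<forall>i\<ge>2. f i = 0)}"
  have B: "submod S ?B"
    using I J by (auto simp: ideal_in_def submod_def smul_def fun_apply)
  have neg: "- c * a \<in> I" if "c \<in> S" "a \<in> I" for a c
    using I subringD(4)[OF S \<open>c \<in> S\<close>] that by (auto simp: ideal_in_def)
  \<comment> \<open>The direct sum \<open>?B\<close> is the split extension of \<open>J\<close> in
    coordinate 0 by \<open>I\<close> in coordinate 1; the index of \<open>I\<close> is raised by one
    to match that of \<open>J\<close>.\<close>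
  have PB: "resolvable S (Suc n) ?B"
  proof (rule resolvable_horseshoe[OF S submod_ideal_module[OF I] B submod_ideal_module[OF J] _ _ _ _ _ resolvable_Suc[OF PI] PJ])
    let ?i = "\<lambda>(f :: nat \<Rightarrow> 'a) i :: nat. if i = 1 then f 0 else 0" and ?q = "\<lambda>(f :: nat \<Rightarrow> 'a) i :: nat. if i = 0 then f 0 else 0"
    show "lin S (ideal_module I) ?i" "lin S ?B ?q"
      by (auto simp: lin_def smul_def fun_eq_iff fun_apply)
    show "inj_on ?i (ideal_module I)"
    proof (rule inj_onI)
      fix x y assume xy: "x \<in> ideal_module I" "y \<in> ideal_module I" "?i x = ?i y"
      show "x = y"
      proof
        fix j show "x j = y j" using xy(1,2) fun_cong[OF xy(3), of 1] by (cases j) (auto simp: ideal_module_def)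
      qed
    qed
    show "?q ` ?B = ideal_module J"
    proof (intro equalityI subsetI)
      fix f assume f: "f \<in> ideal_module J"
      then have "f \<in> ?B" "?q f = f" using I by (auto simp: ideal_in_def ideal_module_def fun_eq_iff)
      then show "f \<in> ?q ` ?B" by (intro image_eqI[of _ ?q f]) simp_all
    qed (auto simp: ideal_module_def)
    show "?i ` ideal_module I = {b \<in> ?B. ?q b = 0}"
    proof (intro equalityI subsetI)
      fix f assume "f \<in> {b \<in> ?B. ?q b = 0}"
      then have f: "f \<in> ?B" "?q f = 0" by auto
      let ?f = "\<lambda>i :: nat. if i = 0 then f 1 else (0::'a)"
      have "f = ?i ?f"
      proof
        fix j show "f j = ?i ?f j" using f(1) fun_cong[OF f(2), of 0]
          by (cases "j \<ge> 2") (auto simp: not_le less_Suc_eq numeral_2_eq_2 fun_apply)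
      qed
      moreover have "?f \<in> ideal_module I" using f by (auto simp: ideal_module_def)
      ultimately show "f \<in> ?i ` ideal_module I" by (rule image_eqI[of f ?i ?f])
    qed (use J in \<open>auto simp: ideal_module_def ideal_in_def fun_eq_iff fun_apply\<close>)
  qed
  show ?thesis
  proof (rule resolvable_cone[OF S submod_ideal_module[OF I] B _ _ _ _ _ PI PB])
    let ?i = "\<lambda>(f :: nat \<Rightarrow> 'a) i :: nat. if i = 0 then f 0 else if i = 1 then - z * f 0 else 0"
      and ?q = "\<lambda>(f :: nat \<Rightarrow> 'a) i :: nat. if i = 0 then z * f 0 + f 1 else 0"
    show "lin S (ideal_module I) ?i" "lin S ?B ?q"
      by (auto simp: lin_def smul_def fun_eq_iff fun_apply algebra_simps)
    show "inj_on ?i (ideal_module I)"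
    proof (rule inj_onI)
      fix x y assume xy: "x \<in> ideal_module I" "y \<in> ideal_module I" "?i x = ?i y"
      show "x = y"
      proof
        fix j show "x j = y j" using xy(1,2) fun_cong[OF xy(3), of 0] by (cases j) (auto simp: ideal_module_def)
      qed
    qed
    show "?q ` ?B = ideal_module {z * a + b | a b. a \<in> J \<and> b \<in> I}"
    proof (intro equalityI subsetI)
      fix f assume "f \<in> ideal_module {z * a + b | a b. a \<in> J \<and> b \<in> I}"
      then obtain a b where ab: "a \<in> J" "b \<in> I" "f 0 = z * a + b" and f: "\<forall>i\<ge>1. f i = 0"
        by (auto simp: ideal_module_def)
      let ?f = "\<lambda>i :: nat. if i = 0 then a else if i = 1 then b else (0::'a)"
      have "f = ?q ?f" using ab f by (auto simp: fun_eq_iff)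
      moreover have "?f \<in> ?B" using ab by auto
      ultimately show "f \<in> ?q ` ?B" by (rule image_eqI[of f ?q ?f])
    qed (auto simp: ideal_module_def, blast)
    show "?i ` ideal_module I = {b \<in> ?B. ?q b = 0}"
    proof (intro equalityI subsetI)
      fix f assume "f \<in> {b \<in> ?B. ?q b = 0}"
      then have f: "f \<in> ?B" "?q f = 0" by auto
      from fun_cong[OF f(2), of 0] have e: "z * f 0 + f 1 = 0" by (simp add: fun_apply)
      then have f1: "f 1 = - z * f 0" by (simp add: add_eq_0_iff)
      \<comment> \<open>A kernel vector has the form \<open>(a, - z a)\<close> with
        \<open>z a\<close> in \<open>I\<close>. As \<open>z\<close> is a nonzerodivisor modulo
        \<open>I\<close>, \<open>a\<close> lies in \<open>I\<close> and the vector comes from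
        \<open>?i\<close>.\<close>
      have "- 1 * f 1 \<in> I" using f(1) by (intro neg subringD(1)[OF S]) auto
      then have "z * f 0 \<in> I" using f1 by simp
      then have f0: "f 0 \<in> I" using nzd f(1) J by (auto simp: ideal_in_def)
      let ?f = "\<lambda>i :: nat. if i = 0 then f 0 else (0::'a)"
      have "f = ?i ?f"
      proof
        fix j show "f j = ?i ?f j" using f(1) f1
          by (cases "j \<ge> 2") (auto simp: not_le less_Suc_eq numeral_2_eq_2)
      qed
      moreover have "?f \<in> ideal_module I" using f0 by (auto simp: ideal_module_def)
      ultimately show "f \<in> ?i ` ideal_module I" by (rule image_eqI[of f ?i ?f])
    next
      fix f assume "f \<in> ?i ` ideal_module I"
      then show "f \<in> {b \<in> ?B. ?q b = 0}"
        using neg[OF z] IJ by (auto simp: ideal_module_def fun_eq_iff fun_apply)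
    qed
  qed
qed

section \<open>Passage to resolutions given by matrices\<close>

lemma sum_apply: "(\<Sum>j\<in>J. F j) i = (\<Sum>j\<in>J. F j i)"
  for F :: "'b \<Rightarrow> nat \<Rightarrow> 'r::comm_ring_1"
  by (induction J rule: infinite_finite_induct) (simp_all add: fun_apply)

lemma lincomb_apply: "lincomb r g f i = (\<Sum>j<r. f j * g j i)"
  by (simp add: lincomb_def sum_apply) (simp add: smul_def)

lemma freemod_eq_free_mod: "freemod k V r = free_mod (polyring k V) r"
  by (simp add: freemod_def free_mod_def)

text \<open>The generators are the columns of the matrix; they must vanish from row \<open>m\<close>
  on because \<open>matmap\<close> truncates there.\<close>

lemma matmap_eq_lincomb:
  assumes "\<And>i j. j < s \<Longrightarrow> m \<le> i \<Longrightarrow> g j i = 0"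
  shows "matmap (\<lambda>i j. g j i) m s f = lincomb s g f"
proof
  fix i show "matmap (\<lambda>i j. g j i) m s f i = lincomb s g f i"
    using assms by (cases "i < m") (simp_all add: matmap_def lincomb_apply mult.commute)
qed

text \<open>Resolutions of an arbitrary submodule of a free module of rank \<open>m\<close>, since
  the recursion passes from an ideal to kernels of higher rank.\<close>

definition free_resolution :: "'k::field itself \<Rightarrow> 'a set \<Rightarrow> nat \<Rightarrow> nat \<Rightarrow> (nat \<Rightarrow> ('a, 'k) mpoly) set \<Rightarrow>
    (nat \<Rightarrow> nat) \<Rightarrow> (nat \<Rightarrow> nat \<Rightarrow> nat \<Rightarrow> ('a, 'k) mpoly) \<Rightarrow> bool" where
  "free_resolution k V n m M r A \<longleftrightarrow> r 0 = m \<and>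
     (\<forall>i\<in>{1..n}. is_matrix k V (r (i - 1)) (r i) (A i)) \<and>
     (if n = 0 then M = {0} else matmap (A 1) (r 0) (r 1) ` freemod k V (r 1) = M) \<and>
     (\<forall>i. 1 \<le> i \<and> i < n \<longrightarrow>
        {f \<in> freemod k V (r i). matmap (A i) (r (i - 1)) (r i) f = (\<lambda>_. 0)}
          = matmap (A (i + 1)) (r i) (r (i + 1)) ` freemod k V (r (i + 1))) \<and>
     (n \<ge> 1 \<longrightarrow> {f \<in> freemod k V (r n). matmap (A n) (r (n - 1)) (r n) f = (\<lambda>_. 0)} = {\<lambda>_. 0})"

text \<open>A presentation by \<open>s\<close> generators is put in front of a resolution of its
  kernel, which sits in rank \<open>s\<close>; hence \<open>m\<close> varies in the
  induction.\<close>

lemma resolvable_imp_free_resolution: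
  fixes k :: "'k::field itself" and V :: "'a set"
  assumes S: "subring (polyring k V)"
  shows "resolvable (polyring k V) n M \<Longrightarrow> M \<subseteq> freemod k V m \<Longrightarrow> \<exists>r A. free_resolution k V n m M r A"
proof (induction n arbitrary: M m)
  case 0
  then show ?case by (intro exI[of _ "\<lambda>_. m"]) (simp add: free_resolution_def)
next
  case (Suc n)
  then obtain s g where g: "lincomb s g ` freemod k V s = M"
    and K: "resolvable (polyring k V) n {f \<in> freemod k V s. lincomb s g f = 0}"
    by (auto simp: freemod_eq_free_mod)
  have gM: "g j \<in> freemod k V m" if "j < s" for j
    using generator_in_image[OF S _ that] g Suc.prems(2) unfolding freemod_eq_free_mod by blast
  have mm: "matmap (\<lambda>i j. g j i) m s f = lincomb s g f" for f
    using gM by (intro matmap_eq_lincomb) (auto simp: freemod_def)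
  let ?K = "{f \<in> freemod k V s. lincomb s g f = 0}"
  obtain r A where "free_resolution k V n s ?K r A" using Suc.IH[OF K, of s] by auto
  note fr = this[unfolded free_resolution_def]
  from fr have r: "r 0 = s"
    and A: "\<forall>i\<in>{1..n}. is_matrix k V (r (i - 1)) (r i) (A i)"
    and im: "if n = 0 then ?K = {0} else matmap (A 1) (r 0) (r 1) ` freemod k V (r 1) = ?K"
    and ex: "\<forall>i. 1 \<le> i \<and> i < n \<longrightarrow>
        {f \<in> freemod k V (r i). matmap (A i) (r (i - 1)) (r i) f = (\<lambda>_. 0)}
          = matmap (A (i + 1)) (r i) (r (i + 1)) ` freemod k V (r (i + 1))"
    and inj: "n \<ge> 1 \<longrightarrow> {f \<in> freemod k V (r n). matmap (A n) (r (n - 1)) (r n) f = (\<lambda>_. 0)} = {\<lambda>_. 0}"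
    by - ((elim conjE, assumption)+)
  \<comment> \<open>All ranks and matrices move up by one place, and the generators \<open>g\<close>
    become the columns of the new first matrix.\<close>
  define r' where "r' = case_nat m r"
  define A' where "A' i = (if i = 1 then (\<lambda>i j. g j i) else A (i - 1))" for i
  have [simp]: "r' 0 = m" "r' (Suc i) = r i" "A' (Suc 0) = (\<lambda>i j. g j i)" "i > 0 \<Longrightarrow> A' (Suc i) = A i" for i
    by (simp_all add: r'_def A'_def)
  have "free_resolution k V (Suc n) m M r' A'"
    unfolding free_resolution_def
  proof (intro conjI ballI allI impI)
    show "r' 0 = m" by simp
    fix i assume i: "i \<in> {1..Suc n}"
    then obtain l where l: "i = Suc l" by (cases i) auto
    show "is_matrix k V (r' (i - 1)) (r' i) (A' i)"
    proof (cases l)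
      case 0
      then show ?thesis using gM by (auto simp: l is_matrix_def freemod_def r)
    next
      case (Suc l')
      then show ?thesis using bspec[OF A, of l] i by (simp add: l)
    qed
  next
    show "if Suc n = 0 then M = {0} else matmap (A' 1) (r' 0) (r' 1) ` freemod k V (r' 1) = M"
      using g by (simp add: r mm)
  next
    fix i assume i: "1 \<le> i \<and> i < Suc n"
    then obtain l where l: "i = Suc l" by (cases i) auto
    show "{f \<in> freemod k V (r' i). matmap (A' i) (r' (i - 1)) (r' i) f = (\<lambda>_. 0)}
          = matmap (A' (i + 1)) (r' i) (r' (i + 1)) ` freemod k V (r' (i + 1))"
    proof (cases l)
      \<comment> \<open>At the seam, the kernel of the matrix of generators is \<open>?K\<close>,
        and by \<open>im\<close> the next matrix maps onto \<open>?K\<close>.\<close>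
      case 0
      then show ?thesis using im i by (simp add: l r mm zero_fun_def)
    next
      case (Suc l')
      then show ?thesis using spec[OF ex, of l] i by (simp add: l)
    qed
  next
    show "{f \<in> freemod k V (r' (Suc n)). matmap (A' (Suc n)) (r' (Suc n - 1)) (r' (Suc n)) f = (\<lambda>_. 0)} = {\<lambda>_. 0}"
    proof (cases n)
      \<comment> \<open>For \<open>n = 0\<close> the kernel \<open>?K\<close> vanishes, so the
        matrix of generators is itself injective.\<close>
      case 0
      then show ?thesis using im by (simp add: r mm zero_fun_def)
    next
      case (Suc l)
      then show ?thesis using inj by simp
    qed
  qed
  then show ?case by blast
qed

section \<open>Squarefree monomial ideals\<close>

text \<open>For \<open>upclosed\<close> \<open>Q\<close> this is a squarefree monomial ideal, with
  \<open>Q\<close> picking out the nonfaces of its Stanley-Reisner complex. Operations on ideals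
  turn into logical operations on \<open>Q\<close>.\<close>

definition support_ideal :: "'a set \<Rightarrow> ('a set \<Rightarrow> bool) \<Rightarrow> ('a, 'k::field) mpoly set" where
  "support_ideal V Q = {p. \<forall>m\<in>Poly_Mapping.keys p. Poly_Mapping.keys m \<subseteq> V \<and> Q (Poly_Mapping.keys m)}"

definition upclosed :: "('a set \<Rightarrow> bool) \<Rightarrow> bool" where
  "upclosed Q \<longleftrightarrow> (\<forall>A B. A \<subseteq> B \<longrightarrow> Q A \<longrightarrow> Q B)"

lemma upclosedD: "upclosed Q \<Longrightarrow> A \<subseteq> B \<Longrightarrow> Q A \<Longrightarrow> Q B"
  unfolding upclosed_def by blast

lemma keys_add_nat: "Poly_Mapping.keys (a + b) = Poly_Mapping.keys a \<union> Poly_Mapping.keys b"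
  for a b :: "'a \<Rightarrow>\<^sub>0 nat"
  by (auto simp: in_keys_iff lookup_add)

lemma support_ideal_True: "support_ideal V (\<lambda>_. True) = polyring k V"
  by (auto simp: support_ideal_def polyring_def)

lemma support_ideal_add:
  "p \<in> support_ideal V Q \<Longrightarrow> q \<in> support_ideal V Q \<Longrightarrow> p + q \<in> support_ideal V Q"
  using subsetD[OF keys_add[of p q]] unfolding support_ideal_def by blast

lemma support_ideal_sum:
  "(\<And>j. j \<in> J \<Longrightarrow> f j \<in> support_ideal V Q) \<Longrightarrow> sum f J \<in> support_ideal V Q"
proof (induction J rule: infinite_finite_induct)
  case (insert j J)
  then show ?case by (simp add: support_ideal_add)
qed (simp_all add: support_ideal_def)

lemma support_ideal_mult:
  assumes "upclosed Q" "c \<in> polyring k V" "p \<in> support_ideal V Q"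
  shows "c * p \<in> support_ideal V Q"
  unfolding support_ideal_def
proof (intro CollectI ballI)
  fix m assume "m \<in> Poly_Mapping.keys (c * p)"
  then obtain a b where ab: "m = a + b" "a \<in> Poly_Mapping.keys c" "b \<in> Poly_Mapping.keys p"
    using keys_mult[of c p] by auto
  then have "Poly_Mapping.keys b \<subseteq> Poly_Mapping.keys m" "Q (Poly_Mapping.keys b)"
    using assms(3) by (simp_all add: support_ideal_def keys_add_nat)
  then have "Q (Poly_Mapping.keys m)" by (rule upclosedD[OF assms(1)])
  then show "Poly_Mapping.keys m \<subseteq> V \<and> Q (Poly_Mapping.keys m)"
    using ab assms(2,3) by (auto simp: support_ideal_def polyring_def keys_add_nat)
qed

lemma subring_polyring: "subring (polyring k V)"
proof -
  have "a - b \<in> polyring k V" if "a \<in> polyring k V" "b \<in> polyring k V" for a b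
    using subsetD[OF keys_diff[of a b]] that unfolding polyring_def by blast
  moreover have "a * b \<in> polyring k V" if "a \<in> polyring k V" "b \<in> polyring k V" for a b
    using support_ideal_mult[of "\<lambda>_. True" a k V b] that
    unfolding upclosed_def support_ideal_True[of V k] by blast
  moreover have "1 \<in> polyring k V" by (simp add: polyring_def)
  ultimately show ?thesis unfolding subring_def by blast
qed

lemma ideal_in_support_ideal: "upclosed Q \<Longrightarrow> ideal_in (polyring k V) (support_ideal V Q)"
  unfolding ideal_in_def
  by (intro conjI ballI support_ideal_add support_ideal_mult)
    (auto simp: support_ideal_def polyring_def)

lemma poly_mapping_sum_single: "p = (\<Sum>m\<in>Poly_Mapping.keys p. Poly_Mapping.single m (Poly_Mapping.lookup p m))"
proof (rule poly_mapping_eqI)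
  fix l
  have "(\<Sum>m\<in>Poly_Mapping.keys p. Poly_Mapping.lookup (Poly_Mapping.single m (Poly_Mapping.lookup p m)) l)
    = (\<Sum>m\<in>Poly_Mapping.keys p. if l = m then Poly_Mapping.lookup p l else 0)"
    by (rule sum.cong) (auto simp: lookup_single when_def)
  then show "Poly_Mapping.lookup p l = Poly_Mapping.lookup (\<Sum>m\<in>Poly_Mapping.keys p. Poly_Mapping.single m (Poly_Mapping.lookup p m)) l"
    by (simp add: lookup_sum in_keys_iff)
qed

lemma lookup_Var_mult:
  "Poly_Mapping.lookup (Var x * p) (Poly_Mapping.single x 1 + m) = Poly_Mapping.lookup p m"
proof -
  have "(\<Sum>q. Poly_Mapping.lookup p q when Poly_Mapping.single x 1 + m = Poly_Mapping.single x 1 + q)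
      = (\<Sum>q. Poly_Mapping.lookup p q when m = q)"
    by (simp only: add_left_cancel)
  then show ?thesis
    by (simp add: lookup_mult Var_def lookup_single when_mult)
qed

text \<open>Multiplication by \<open>Var x\<close> shifts monomials injectively and adds only
  \<open>x\<close> to their supports, which \<open>Q\<close> does not see. So \<open>Var x\<close>
  is a nonzerodivisor modulo such an ideal.\<close>

lemma Var_mult_mem_support_ideal_iff:
  assumes "x \<in> V" "\<And>A. Q A = Q (A - {x})"
  shows "Var x * p \<in> support_ideal V Q \<longleftrightarrow> p \<in> support_ideal V Q"
proof -
  let ?t = "Poly_Mapping.single x (1::nat)"
  have "Poly_Mapping.keys (Var x * p) = (\<lambda>m. ?t + m) ` Poly_Mapping.keys p"
  proof (intro equalityI subsetI)
    fix m assume "m \<in> Poly_Mapping.keys (Var x * p)"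
    then show "m \<in> (\<lambda>m. ?t + m) ` Poly_Mapping.keys p"
      using keys_mult[of "Var x" p] by (auto simp: Var_def)
  qed (use lookup_Var_mult[of x p] in \<open>auto simp: in_keys_iff\<close>)
  moreover have "Q (Poly_Mapping.keys (?t + m)) = Q (Poly_Mapping.keys m)" for m
    using assms(2)[of "Poly_Mapping.keys (?t + m)"] assms(2)[of "Poly_Mapping.keys m"]
    by (simp add: keys_add_nat)
  ultimately show ?thesis
    using assms(1) by (auto simp: support_ideal_def keys_add_nat)
qed

text \<open>Term by term, a monomial whose support satisfies \<open>Q1\<close> goes into
  \<open>b\<close>; any other is divisible by \<open>x\<close>, and its quotient by \<open>x\<close>
  goes into \<open>a\<close>.\<close>

lemma support_ideal_decompose:
  assumes x: "x \<in> V" and up: "upclosed Q1" "upclosed Q2"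
    and ind: "\<And>A. Q1 A = Q1 (A - {x})" "\<And>A. Q2 A = Q2 (A - {x})"
  shows "support_ideal V (\<lambda>A. Q1 A \<or> x \<in> A \<and> Q2 A) =
    {Var x * a + b | a b. a \<in> support_ideal V Q2 \<and> b \<in> (support_ideal V Q1 :: ('a, 'k::field) mpoly set)}"
    (is "?L = ?R")
proof (intro equalityI subsetI)
  fix p :: "('a, 'k) mpoly" assume p: "p \<in> ?L"
  have add: "q + q' \<in> ?R" if "q \<in> ?R" "q' \<in> ?R" for q q'
  proof -
    from that obtain a b a' b' where
      "q = Var x * a + b" "a \<in> support_ideal V Q2" "b \<in> support_ideal V Q1"
      "q' = Var x * a' + b'" "a' \<in> support_ideal V Q2" "b' \<in> support_ideal V Q1" by blast
    then have "q + q' = Var x * (a + a') + (b + b')" "a + a' \<in> support_ideal V Q2" "b + b' \<in> support_ideal V Q1"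
      by (auto simp: algebra_simps support_ideal_add)
    then show ?thesis by blast
  qed
  have zero: "0 \<in> support_ideal V Q" for Q by (simp add: support_ideal_def)
  have "0 \<in> ?R" using zero by force
  have single: "Poly_Mapping.single m c \<in> ?R" if "m \<in> Poly_Mapping.keys p" for m c
  proof (cases "Q1 (Poly_Mapping.keys m)")
    case True
    then have "Poly_Mapping.single m c \<in> support_ideal V Q1"
      using p that by (auto simp: support_ideal_def)
    then show ?thesis using zero by force
  next
    case False
    then have m: "x \<in> Poly_Mapping.keys m" "Q2 (Poly_Mapping.keys m)" "Poly_Mapping.keys m \<subseteq> V"
      using p that by (auto simp: support_ideal_def)
    \<comment> \<open>The quotient of \<open>m\<close> by \<open>x\<close> may or may not still
      contain \<open>x\<close>; \<open>Q2\<close> ignores \<open>x\<close> and hence carries over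
      from \<open>m\<close> to \<open>m'\<close>.\<close>
    define m' where "m' = m - Poly_Mapping.single x 1"
    have mm': "m = Poly_Mapping.single x 1 + m'"
      using m(1) by (intro poly_mapping_eqI)
        (auto simp: m'_def lookup_add lookup_minus lookup_single when_def in_keys_iff)
    have k: "Poly_Mapping.keys m = insert x (Poly_Mapping.keys m')" by (simp add: mm' keys_add_nat)
    have "Q2 (Poly_Mapping.keys m')"
      using m(2) ind(2)[of "Poly_Mapping.keys m"] ind(2)[of "Poly_Mapping.keys m'"] by (simp add: k)
    then have "Poly_Mapping.single m' c \<in> support_ideal V Q2"
      using m(3) by (simp add: support_ideal_def k)
    moreover have "Poly_Mapping.single m c = Var x * Poly_Mapping.single m' c"
      by (simp add: Var_def mult_single mm')
    ultimately show ?thesis using zero by force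
  qed
  have "J \<subseteq> Poly_Mapping.keys p \<Longrightarrow> (\<Sum>m\<in>J. Poly_Mapping.single m (Poly_Mapping.lookup p m)) \<in> ?R" for J
  proof (induction J rule: infinite_finite_induct)
    case (insert m J)
    then have "Poly_Mapping.single m (Poly_Mapping.lookup p m) + (\<Sum>m\<in>J. Poly_Mapping.single m (Poly_Mapping.lookup p m)) \<in> ?R"
      by (intro add single) auto
    with insert show ?case by simp
  qed (use \<open>0 \<in> ?R\<close> in simp_all)
  from this[OF order_refl] show "p \<in> ?R" by (simp only: poly_mapping_sum_single[symmetric])
next
  fix p :: "('a, 'k) mpoly" assume "p \<in> ?R"
  then obtain a b where ab: "p = Var x * a + b" "a \<in> support_ideal V Q2" "b \<in> support_ideal V Q1" by blast
  have "b \<in> ?L" using ab(3) by (auto simp: support_ideal_def)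
  moreover have "Var x * a \<in> ?L"
    unfolding support_ideal_def
  proof (intro CollectI ballI)
    fix m assume "m \<in> Poly_Mapping.keys (Var x * a)"
    then obtain m' where m': "m = Poly_Mapping.single x 1 + m'" "m' \<in> Poly_Mapping.keys a"
      using keys_mult[of "Var x" a] by (auto simp: Var_def)
    have "Q2 (Poly_Mapping.keys m)"
      by (rule upclosedD[OF up(2), of "Poly_Mapping.keys m'"])
        (use m' ab(2) in \<open>auto simp: support_ideal_def keys_add_nat\<close>)
    then show "Poly_Mapping.keys m \<subseteq> V \<and> (Q1 (Poly_Mapping.keys m) \<or> x \<in> Poly_Mapping.keys m \<and> Q2 (Poly_Mapping.keys m))"
      using m' ab(2) x by (auto simp: support_ideal_def keys_add_nat)
  qed
  ultimately show "p \<in> ?L" unfolding ab(1) by (intro support_ideal_add)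
qed

section \<open>Projective dimension of squarefree monomial ideals\<close>

definition pd_le :: "'k::field itself \<Rightarrow> 'a set \<Rightarrow> nat \<Rightarrow> ('a set \<Rightarrow> bool) \<Rightarrow> bool" where
  "pd_le k V n Q \<longleftrightarrow> resolvable (polyring k V) n (ideal_module (support_ideal V Q :: ('a, 'k) mpoly set))"

lemma pd_le_mono: "m \<le> n \<Longrightarrow> pd_le k V m Q \<Longrightarrow> pd_le k V n Q"
  by (auto simp: pd_le_def intro: resolvable_mono)

text \<open>Here \<open>Q1\<close> and \<open>Q2\<close> describe the ideals \<open>I\<close> and
  \<open>J\<close> of \<open>resolvable_add_mult\<close>, with \<open>Var x\<close> as
  \<open>z\<close>.\<close>

lemma pd_le_add_Var_mult:
  fixes k :: "'k::field itself"
  assumes x: "x \<in> V" and up: "upclosed Q1" "upclosed Q2"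
    and ind: "\<And>A. Q1 A = Q1 (A - {x})" "\<And>A. Q2 A = Q2 (A - {x})"
    and le: "\<And>A. Q1 A \<Longrightarrow> Q2 A"
    and "pd_le k V n Q1" "pd_le k V (Suc n) Q2"
  shows "pd_le k V (Suc n) (\<lambda>A. Q1 A \<or> x \<in> A \<and> Q2 A)"
  unfolding pd_le_def support_ideal_decompose[OF x up ind]
proof (rule resolvable_add_mult[OF subring_polyring ideal_in_support_ideal[OF up(1)] ideal_in_support_ideal[OF up(2)]])
  show "support_ideal V Q1 \<subseteq> (support_ideal V Q2 :: ('a, 'k) mpoly set)" using le by (auto simp: support_ideal_def)
  show "Var x \<in> polyring k V" using x by (auto simp: polyring_def Var_def)
  show "a \<in> support_ideal V Q1" if "Var x * a \<in> support_ideal V Q1" for a :: "('a, 'k) mpoly"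
    by (rule Var_mult_mem_support_ideal_iff[of x V Q1 a, OF x ind(1), THEN iffD1, OF that])
  show "resolvable (polyring k V) n (ideal_module (support_ideal V Q1 :: ('a, 'k) mpoly set))"
    "resolvable (polyring k V) (Suc n) (ideal_module (support_ideal V Q2 :: ('a, 'k) mpoly set))"
    using assms(7,8) unfolding pd_le_def .
qed

lemma pd_le_True: "pd_le k V (Suc n) (\<lambda>_. True)"
  unfolding pd_le_def support_ideal_True[of V k] by (rule resolvable_unit_ideal[OF subring_polyring])

text \<open>Adding a variable that \<open>Q\<close> ignores is the case where \<open>J\<close> is
  the whole ring, so each variable costs one.\<close>

lemma pd_le_add_variables:
  assumes "finite Y" "Y \<subseteq> V" "upclosed Q" "\<And>A. Q A = Q (A - Y)" "pd_le k V n Q"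
  shows "pd_le k V (n + card Y) (\<lambda>A. Q A \<or> A \<inter> Y \<noteq> {})"
  using assms
proof (induction Y)
  case empty
  show ?case using empty.prems(4) by simp
next
  case (insert y Y)
  let ?Q = "\<lambda>A. Q A \<or> A \<inter> Y \<noteq> {}"
  \<comment> \<open>\<open>Q\<close> depends only on the part of a set outside
    \<open>insert y Y\<close>, which gives its independence both of \<open>Y\<close> and of
    \<open>y\<close>.\<close>
  have i: "Q A = Q B" if "A - insert y Y = B - insert y Y" for A B
  proof -
    have "Q A = Q (A - insert y Y)" by (rule insert.prems(3))
    also have "\<dots> = Q (B - insert y Y)" by (simp only: that)
    also have "\<dots> = Q B" by (rule insert.prems(3)[symmetric])
    finally show ?thesis .
  qed
  have "pd_le k V (n + card Y) ?Q"
    by (rule insert.IH[OF _ insert.prems(2) i insert.prems(4)]) (use insert.prems(1) in auto)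
  then have pd: "pd_le k V (Suc (n + card Y)) (\<lambda>A. ?Q A \<or> y \<in> A \<and> True)"
  proof (rule pd_le_add_Var_mult[rotated -2, OF _ pd_le_True])
    show "upclosed ?Q" using insert.prems(2) unfolding upclosed_def by blast
    show "?Q A = ?Q (A - {y})" for A
    proof -
      have "Q A = Q (A - {y})" by (rule i) auto
      then show ?thesis using insert.hyps(2) by blast
    qed
  qed (use insert.prems(1) in \<open>auto simp: upclosed_def\<close>)
  have eq: "(\<lambda>A. ?Q A \<or> y \<in> A \<and> True) = (\<lambda>A. Q A \<or> A \<inter> insert y Y \<noteq> {})" by auto
  show ?case
    unfolding card_insert_disjoint[OF insert.hyps] add_Suc_right
    by (rule subst[OF eq, of "pd_le k V (Suc (n + card Y))", OF pd])
qed

section \<open>Edge ideals\<close>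

definition has_edge :: "'a graph \<Rightarrow> 'a set \<Rightarrow> bool" where
  "has_edge G A \<longleftrightarrow> (\<exists>u\<in>A. \<exists>w\<in>A. snd G u w)"

text \<open>The predicate with \<open>A - X\<close> belongs to the edge ideal of \<open>G\<close>
  with \<open>X\<close> deleted, while the ambient variables stay the same.\<close>

lemma upclosed_has_edge: "upclosed (\<lambda>A. has_edge G (A - X))"
  unfolding upclosed_def has_edge_def by blast

text \<open>A monomial is divisible by an edge monomial exactly when its support contains both ends
  of that edge.\<close>

lemma edge_ideal_eq_support_ideal:
  fixes k :: "'k::field itself"
  assumes G: "finite_simple_graph G"
  shows "edge_ideal k G = support_ideal (fst G) (has_edge G)"
proof (intro equalityI subsetI)
  fix p assume "p \<in> edge_ideal k G"
  then obtain F c where F: "F \<subseteq> {(u, w). snd G u w}" "\<forall>e\<in>F. c e \<in> polyring k (fst G)"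
    and p: "p = (\<Sum>e\<in>F. c e * (Var (fst e) * Var (snd e)))"
    unfolding edge_ideal_def by blast
  show "p \<in> support_ideal (fst G) (has_edge G)"
    unfolding p
  proof (rule support_ideal_sum, rule support_ideal_mult[where k = k])
    show "upclosed (has_edge G)" using upclosed_has_edge[of G "{}"] by simp
    fix e assume e: "e \<in> F"
    then have s: "snd G (fst e) (snd e)" using F by auto
    then have "fst e \<in> fst G" "snd e \<in> fst G" using G unfolding finite_simple_graph_def by blast+
    then show "Var (fst e) * Var (snd e) \<in> support_ideal (fst G) (has_edge G)"
      using s by (auto simp: Var_def mult_single support_ideal_def keys_add_nat has_edge_def)
  qed (use F in auto)
next
  fix p :: "('a, 'k) mpoly" assume p: "p \<in> support_ideal (fst G) (has_edge G)"
  have "\<exists>e c. snd G (fst e) (snd e) \<and> c \<in> polyring k (fst G) \<and>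
      Poly_Mapping.single m (Poly_Mapping.lookup p m) = c * (Var (fst e) * Var (snd e))"
    if "m \<in> Poly_Mapping.keys p" for m
  proof -
    from p that have m: "Poly_Mapping.keys m \<subseteq> fst G" "has_edge G (Poly_Mapping.keys m)"
      by (auto simp: support_ideal_def)
    then obtain u w where uw: "u \<in> Poly_Mapping.keys m" "w \<in> Poly_Mapping.keys m" "snd G u w"
      by (auto simp: has_edge_def)
    then have "u \<noteq> w" using G by (auto simp: finite_simple_graph_def)
    \<comment> \<open>As \<open>u\<close> and \<open>w\<close> are distinct, the product of both
      variables divides \<open>m\<close>, and \<open>m'\<close> is the quotient.\<close>
    define m' where "m' = m - (Poly_Mapping.single u 1 + Poly_Mapping.single w 1)"
    have mm': "m = m' + (Poly_Mapping.single u 1 + Poly_Mapping.single w 1)"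
      using uw \<open>u \<noteq> w\<close> by (intro poly_mapping_eqI)
        (auto simp: m'_def lookup_add lookup_minus lookup_single when_def in_keys_iff)
    have "Poly_Mapping.keys m' \<subseteq> Poly_Mapping.keys m" 
      using arg_cong[OF mm', of Poly_Mapping.keys] by (auto simp: keys_add_nat)
    then have "Poly_Mapping.single m' (Poly_Mapping.lookup p m) \<in> polyring k (fst G)"
      using m(1) by (auto simp: polyring_def)
    moreover have "Poly_Mapping.single m (Poly_Mapping.lookup p m)
        = Poly_Mapping.single m' (Poly_Mapping.lookup p m) * (Var u * Var w)"
      unfolding Var_def mult_single mm'[symmetric] by simp
    ultimately show ?thesis using uw(3) by (intro exI[of _ "(u, w)"]) auto
  qed
  then obtain e c where ec: "\<And>m. m \<in> Poly_Mapping.keys p \<Longrightarrow> snd G (fst (e m)) (snd (e m)) \<and>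
      c m \<in> polyring k (fst G) \<and>
      Poly_Mapping.single m (Poly_Mapping.lookup p m) = c m * (Var (fst (e m)) * Var (snd (e m)))"
    by metis
  let ?K = "Poly_Mapping.keys p"
  have "(\<Sum>m\<in>?K. Poly_Mapping.single m (Poly_Mapping.lookup p m)) =
      (\<Sum>m\<in>?K. c m * (Var (fst (e m)) * Var (snd (e m))))"
    by (rule sum.cong) (use ec in auto)
  then have "p = (\<Sum>m\<in>?K. c m * (Var (fst (e m)) * Var (snd (e m))))"
    by (simp only: poly_mapping_sum_single[symmetric])
  \<comment> \<open>Several monomials may have chosen the same edge, whereas
    \<open>edge_ideal\<close> has one coefficient per edge; the terms are grouped
    accordingly.\<close>
  also have "\<dots> = (\<Sum>x\<in>e ` ?K. \<Sum>m\<in>{m \<in> ?K. e m = x}. c m * (Var (fst (e m)) * Var (snd (e m))))"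
    by (rule sum.image_gen) simp
  also have "\<dots> = (\<Sum>x\<in>e ` ?K. (\<Sum>m\<in>{m \<in> ?K. e m = x}. c m) * (Var (fst x) * Var (snd x)))"
    by (simp add: sum_distrib_right)
  finally have pp: "p = \<dots>" .
  have "(\<Sum>m\<in>{m \<in> ?K. e m = x}. c m) \<in> polyring k (fst G)" for x
    unfolding support_ideal_True[symmetric] by (rule support_ideal_sum) (use ec in \<open>auto simp: support_ideal_True[of _ k]\<close>)
  moreover have "e ` ?K \<subseteq> {(u, w). snd G u w}" using ec by (simp add: image_subset_iff case_prod_beta)
  ultimately show "p \<in> edge_ideal k G"
    unfolding edge_ideal_def
    by (intro CollectI exI[of _ "e ` ?K"] exI[of _ "\<lambda>x. \<Sum>m\<in>{m \<in> ?K. e m = x}. c m"] conjI pp ballI finite_imageI finite_keys)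
qed

lemma pd_le_imp_pd:
  assumes G: "finite_simple_graph G" and "pd_le k (fst G) n (has_edge G)"
  shows "pd k G \<le> n"
proof -
  have M: "ideal_module (edge_ideal k G) = {f \<in> freemod k (fst G) 1. f 0 \<in> edge_ideal k G}"
    by (auto simp: ideal_module_def freemod_def edge_ideal_eq_support_ideal[OF G] support_ideal_def polyring_def)
  \<comment> \<open>For \<open>n = 0\<close> one notion of resolution says that the submodule is
    zero, the other that the ideal is.\<close>
  have z: "ideal_module (edge_ideal k G) = {0} \<Longrightarrow> edge_ideal k G = {0}"
  proof (intro equalityI subsetI)
    fix p assume *: "ideal_module (edge_ideal k G) = {0}" "p \<in> edge_ideal k G"
    have "(\<lambda>i. if i = 0 then p else 0) \<in> ideal_module (edge_ideal k G)"
      using *(2) by (simp add: ideal_module_def)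
    then have "(\<lambda>i. if i = (0::nat) then p else 0) = 0" by (simp only: *(1) singleton_iff)
    from fun_cong[OF this, of 0] show "p \<in> {0}" by (simp add: fun_apply)
  qed (simp add: edge_ideal_eq_support_ideal[OF G] support_ideal_def)
  have "resolvable (polyring k (fst G)) n (ideal_module (edge_ideal k G))"
    using assms(2) by (simp add: pd_le_def edge_ideal_eq_support_ideal[OF G])
  then obtain r A where "free_resolution k (fst G) n 1 (ideal_module (edge_ideal k G)) r A"
    using resolvable_imp_free_resolution[OF subring_polyring, of k "fst G" n _ 1] M by blast
  then have "is_free_resolution k G n r A"
    using z unfolding is_free_resolution_def free_resolution_def
    by (-, elim conjE, cases "n = 0", simp_all add: M)
  then show ?thesis unfolding pd_def by (intro Least_le) blast
qed

section \<open>Vertex deletion and the inductive bound\<close>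

lemma del_vertices_eq:
  assumes "finite_simple_graph G"
  shows "del_vertices G xs = (fst G - set xs, \<lambda>u w. snd G u w \<and> u \<notin> set xs \<and> w \<notin> set xs)"
proof (induction xs rule: rev_induct)
  case Nil
  show ?case by (simp add: del_vertices_def)
next
  case (snoc x xs)
  have "del_vertices G (xs @ [x]) = del_vertex (del_vertices G xs) x"
    by (simp add: del_vertices_def)
  also have "\<dots> = (fst G - set (xs @ [x]), \<lambda>u w. snd G u w \<and> u \<notin> set (xs @ [x]) \<and> w \<notin> set (xs @ [x]))"
    using assms unfolding snoc.IH del_vertex_def finite_simple_graph_def by (auto simp: fun_eq_iff)
  finally show ?case .
qed

lemma has_edge_del_vertices:
  "finite_simple_graph G \<Longrightarrow> has_edge (del_vertices G xs) A = has_edge G (A - set xs)"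
  by (auto simp: del_vertices_eq has_edge_def)

lemma hereditary_del_vertices:
  assumes her: "hereditary \<C>" and mono: "\<And>G v. G \<in> \<C> \<Longrightarrow> v \<in> fst G \<Longrightarrow> (h (del_vertex G v) :: real) \<le> h G"
  shows "G \<in> \<C> \<Longrightarrow> distinct xs \<Longrightarrow> set xs \<subseteq> fst G \<Longrightarrow> del_vertices G xs \<in> \<C> \<and> h (del_vertices G xs) \<le> h G"
proof (induction xs arbitrary: G)
  case Nil
  then show ?case by (simp add: del_vertices_def)
next
  case (Cons x xs)
  have "del_vertex G x \<in> \<C>" using her Cons.prems by (auto simp: hereditary_def)
  moreover have "set xs \<subseteq> fst (del_vertex G x)" using Cons.prems by (auto simp: del_vertex_def)
  ultimately have "del_vertices (del_vertex G x) xs \<in> \<C>" "h (del_vertices (del_vertex G x) xs) \<le> h (del_vertex G x)"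
    using Cons by auto
  moreover have "h (del_vertex G x) \<le> h G" using mono Cons.prems by auto
  moreover have "del_vertices G (x # xs) = del_vertices (del_vertex G x) xs" by (simp add: del_vertices_def)
  ultimately show ?case by simp
qed

text \<open>An edge either avoids \<open>x\<close> or joins \<open>x\<close> to a neighbour, so the
  ideal is \<open>I + xJ\<close> with \<open>I\<close> from \<open>G - x\<close> and
  \<open>J\<close> generated by \<open>I\<close> and the variables in \<open>N(x)\<close>.\<close>

lemma pd_le_has_edge_step:
  assumes G: "finite_simple_graph G" and V: "fst G \<subseteq> V" and x: "x \<in> fst G"
    and a: "pd_le k V a (\<lambda>A. has_edge G (A - {x}))"
    and b: "pd_le k V b (\<lambda>A. has_edge G (A - insert x (neighbors G x)))"
    and m: "Suc a \<le> m" "b + degree G x \<le> m"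
  shows "pd_le k V m (has_edge G)"
proof -
  let ?N = "neighbors G x"
  let ?Q1 = "\<lambda>A. has_edge G (A - {x})" and ?Q2 = "\<lambda>A. has_edge G (A - {x}) \<or> A \<inter> ?N \<noteq> {}"
  obtain m' where m': "m = Suc m'" using m(1) by (cases m) auto
  have N: "finite ?N" "?N \<subseteq> V" "x \<notin> ?N"
    using G V by (auto simp: neighbors_def finite_simple_graph_def)
  have "pd_le k V (b + card ?N) (\<lambda>A. has_edge G (A - insert x ?N) \<or> A \<inter> ?N \<noteq> {})"
  proof (rule pd_le_add_variables[OF N(1,2) upclosed_has_edge _ b])
    fix A
    have "A - ?N - insert x ?N = A - insert x ?N" by auto
    then show "has_edge G (A - insert x ?N) = has_edge G (A - ?N - insert x ?N)" by simp
  qed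
  \<comment> \<open>An edge avoiding \<open>x\<close> meets \<open>?N\<close> or lies outside the
    closed neighbourhood of \<open>x\<close>.\<close>
  moreover have "(\<lambda>A. has_edge G (A - insert x ?N) \<or> A \<inter> ?N \<noteq> {}) = ?Q2"
    by (intro ext) (auto simp: has_edge_def)
  ultimately have 2: "pd_le k V m ?Q2"
    using m(2) by (auto simp: degree_def intro: pd_le_mono)
  have 1: "pd_le k V m' ?Q1"
    using m(1) by (intro pd_le_mono[OF _ a]) (simp add: m')
  have "pd_le k V (Suc m') (\<lambda>A. ?Q1 A \<or> x \<in> A \<and> ?Q2 A)"
  proof (rule pd_le_add_Var_mult)
    show "x \<in> V" using x V by blast
    show "upclosed ?Q1" by (rule upclosed_has_edge)
    show "upclosed ?Q2" unfolding upclosed_def has_edge_def by blast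
    show "?Q1 A = ?Q1 (A - {x})" "?Q2 A = ?Q2 (A - {x})" for A using N(3) by auto
    show "pd_le k V (Suc m') ?Q2" using 2 by (simp only: m')
  qed (use 1 in simp_all)
  moreover have "(\<lambda>A. ?Q1 A \<or> x \<in> A \<and> ?Q2 A) = has_edge G"
  proof
    fix A show "(?Q1 A \<or> x \<in> A \<and> ?Q2 A) = has_edge G A"
      using G unfolding has_edge_def neighbors_def finite_simple_graph_def by blast
  qed
  ultimately show ?thesis by (simp only: m')
qed

lemma pd_le_no_edge: "(\<And>A. \<not> Q A) \<Longrightarrow> pd_le k V 0 Q"
proof -
  assume "\<And>A. \<not> Q A"
  then have "support_ideal V Q = {0 :: ('a, 'b) mpoly}"
    by (auto simp: support_ideal_def)
  moreover have "ideal_module {0} = {0 :: nat \<Rightarrow> ('a, 'b) mpoly}"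
  proof (intro equalityI subsetI)
    fix f :: "nat \<Rightarrow> ('a, 'b) mpoly" assume "f \<in> ideal_module {0}"
    then have "f i = 0" for i by (cases i) (auto simp: ideal_module_def)
    then show "f \<in> {0}" by (auto simp: fun_eq_iff fun_apply)
  qed (simp add: ideal_module_def fun_apply)
  ultimately show ?thesis by (simp add: pd_le_def)
qed

text \<open>Strong induction on the number of vertices with \<open>V\<close> kept fixed, so that
  smaller graphs are resolved over the same ring.\<close>

lemma pd_le_hereditary:
  fixes \<C> :: "'a graph set" and h :: "'a graph \<Rightarrow> real" and k :: "'k::field itself"
  assumes hered: "hereditary \<C>"
    and mono: "\<And>G v. G \<in> \<C> \<Longrightarrow> v \<in> fst G \<Longrightarrow> h (del_vertex G v) \<le> h G"
    and order: "\<And>G. G \<in> \<C> \<Longrightarrow> fst G \<noteq> {} \<Longrightarrow> \<exists>v\<in>fst G. \<exists>vs. distinct vs \<and> set vs = neighbors G v \<and>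
          (\<forall>i < length vs. real i + real (degree (del_vertices G (take i vs)) (vs ! i)) + 1 \<le> h G) \<and>
          real (length vs) + 1 \<le> h G"
  shows "G \<in> \<C> \<Longrightarrow> fst G \<subseteq> V \<Longrightarrow>
    \<exists>n. real n \<le> real (card (fst G)) * (1 - 1 / h G) \<and> pd_le k V n (has_edge G)"
proof (induction "card (fst G)" arbitrary: G rule: less_induct)
  case less
  have G: "finite_simple_graph G" and fin: "finite (fst G)"
    using hered less.prems by (auto simp: hereditary_def finite_simple_graph_def)
  show ?case
  proof (cases "fst G = {}")
    case True
    then have "\<not> has_edge G A" for A using G by (auto simp: has_edge_def finite_simple_graph_def)
    then show ?thesis using True pd_le_no_edge[of "has_edge G"] by (intro exI[of _ 0]) simp
  next
    case False
    obtain v vs where v: "v \<in> fst G" and vs: "distinct vs" "set vs = neighbors G v"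
      and ord: "\<And>i. i < length vs \<Longrightarrow> real i + real (degree (del_vertices G (take i vs)) (vs ! i)) + 1 \<le> h G"
      and len: "real (length vs) + 1 \<le> h G"
      using order[OF less.prems(1) False] by blast
    have v_vs: "v \<notin> set vs" and vsG: "set vs \<subseteq> fst G"
      using G vs(2) by (auto simp: neighbors_def finite_simple_graph_def)
    define n H where "n = card (fst G)" and "H = h G"
    \<comment> \<open>Resolution lengths are integers, so the real bound may be rounded
      down.\<close>
    define N where "N = nat \<lfloor>real n * (1 - 1 / H)\<rfloor>"
    have H1: "H \<ge> 1" using len by (simp add: H_def)
    have nonneg: "0 \<le> real n * (1 - 1 / H)" using H1 by (intro mult_nonneg_nonneg) auto
    \<comment> \<open>With \<open>t = length xs\<close>, the induction hypothesis leads to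
      \<open>(n - t)(1 - 1/H) = n(1 - 1/H) - t + t/H\<close>, and \<open>t/H \<le> 1\<close> leaves
      at most \<open>N + 1 - t\<close>. The first conjunct keeps the natural subtraction
      exact.\<close>
    have del: "length xs \<le> Suc N \<and> pd_le k V (Suc N - length xs) (\<lambda>A. has_edge G (A - set xs))"
      if xs: "distinct xs" "set xs \<subseteq> fst G" "xs \<noteq> []" "real (length xs) \<le> H" for xs
    proof -
      let ?D = "del_vertices G xs"
      have D: "?D \<in> \<C>" "h ?D \<le> H"
        using hereditary_del_vertices[where h = h, OF hered mono less.prems(1) xs(1,2)] by (auto simp: H_def)
      have fD: "fst ?D = fst G - set xs" by (simp add: del_vertices_eq[OF G])
      have le: "length xs \<le> n"
        using card_mono[OF fin xs(2)] distinct_card[OF xs(1)] by (simp add: n_def)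
      have cD: "card (fst ?D) = n - length xs"
        using xs(1,2) by (simp add: fD card_Diff_subset distinct_card n_def)
      have "length xs > 0" using xs(3) by simp
      then have "card (fst ?D) < card (fst G)" using cD le unfolding n_def by linarith
      then obtain m where m: "real m \<le> real (card (fst ?D)) * (1 - 1 / h ?D)"
        and pm: "pd_le k V m (has_edge ?D)"
        using less.hyps[of ?D] D(1) less.prems(2) fD by blast
      have "real m \<le> real (n - length xs) * (1 - 1 / H)"
      \<comment> \<open>\<open>order\<close> gives no lower bound for \<open>h\<close> on the empty
        graph; there the number of vertices makes the product zero.\<close>
      proof (cases "fst ?D = {}")
        case True
        then show ?thesis using m cD by simp
      next
        case False
        from order[OF D(1) this] have "h ?D \<ge> 1" by force
        then have "1 - 1 / h ?D \<le> 1 - 1 / H" using D(2) by (simp add: frac_le)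
        then show ?thesis using m unfolding cD by (meson mult_left_mono of_nat_0_le_iff order_trans)
      qed
      also have "\<dots> = real n * (1 - 1 / H) - real (length xs) + real (length xs) / H"
        using le by (simp add: of_nat_diff algebra_simps diff_divide_distrib)
      also have "\<dots> \<le> real n * (1 - 1 / H) - real (length xs) + 1"
        using xs(4) H1 by simp
      finally have "real (m + length xs - 1) \<le> real n * (1 - 1 / H)"
        using \<open>length xs > 0\<close> by linarith
      then have "m + length xs - 1 \<le> N"
        unfolding N_def by (rule le_nat_floor)
      then have l: "length xs \<le> Suc N" "m \<le> Suc N - length xs" by auto
      have "has_edge ?D = (\<lambda>A. has_edge G (A - set xs))"
        by (rule ext) (rule has_edge_del_vertices[OF G])
      then show ?thesis using l pd_le_mono[OF l(2) pm] by simp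
    qed
    \<comment> \<open>Without its neighbours \<open>v\<close> is isolated, so deleting it as well
      leaves the ideal unchanged, and \<open>del\<close> may count one more vertex.\<close>
    have base0: "length vs \<le> N \<and> pd_le k V (N - length vs) (\<lambda>A. has_edge G (A - set vs))"
    proof -
      have "u \<noteq> v \<and> w \<noteq> v" if "snd G u w" "u \<notin> set vs" "w \<notin> set vs" for u w
        using G that unfolding vs(2) neighbors_def finite_simple_graph_def by blast
      then have "(\<lambda>A. has_edge G (A - set (vs @ [v]))) = (\<lambda>A. has_edge G (A - set vs))"
        unfolding has_edge_def by (intro ext) auto
      moreover have "length (vs @ [v]) \<le> Suc N \<and>
          pd_le k V (Suc N - length (vs @ [v])) (\<lambda>A. has_edge G (A - set (vs @ [v])))"
        by (rule del) (use vs(1) v v_vs vsG len in \<open>simp_all add: H_def\<close>)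
      ultimately show ?thesis by simp
    qed
    \<comment> \<open>The neighbours are restored one at a time, from \<open>i = length vs\<close>
      down to \<open>i = 0\<close>, which is \<open>G\<close> itself.\<close>
    have "i \<le> length vs \<Longrightarrow> pd_le k V (N - i) (\<lambda>A. has_edge G (A - set (take i vs)))" for i
    proof (induction rule: inc_induct)
      case base
      then show ?case using base0 by simp
    next
      case (step i)
      let ?D = "del_vertices G (take i vs)" and ?x = "vs ! i"
      have "?x \<in> fst G" using nth_mem[OF step.hyps(2)] vsG by blast
      moreover have "?x \<notin> set (take i vs)"
        using step.hyps(2) vs(1) by (auto simp: in_set_conv_nth nth_eq_iff_index_eq)
      ultimately have x: "?x \<in> fst G" "?x \<notin> set (take i vs)" by blast+
      have D: "?D \<in> \<C>"
        using hereditary_del_vertices[where h = h, OF hered mono less.prems(1), of "take i vs"]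
          vs(1) vsG set_take_subset[of i vs] by auto
      then have sD: "finite_simple_graph ?D" using hered by (auto simp: hereditary_def)
      have fD: "fst ?D = fst G - set (take i vs)" by (simp add: del_vertices_eq[OF G])
      obtain ys where ys: "set ys = neighbors ?D ?x" "distinct ys"
        using finite_distinct_list[of "neighbors ?D ?x"] sD
        by (auto simp: neighbors_def finite_simple_graph_def)
      have lys: "length ys = degree ?D ?x" using distinct_card[OF ys(2)] by (simp add: ys(1) degree_def)
      have ysD: "set ys \<subseteq> fst G - set (take i vs)" "?x \<notin> set ys"
        using sD unfolding ys(1) by (auto simp: neighbors_def finite_simple_graph_def fD)
      \<comment> \<open>The first \<open>i\<close> neighbours and the closed neighbourhood of
        \<open>?x\<close> in \<open>?D\<close>: by \<open>ord\<close> these are at most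
        \<open>H\<close> vertices, as \<open>del\<close> requires.\<close>
      let ?zs = "take i vs @ ?x # ys"
      have "length ?zs \<le> Suc N \<and> pd_le k V (Suc N - length ?zs) (\<lambda>A. has_edge G (A - set ?zs))"
      proof (rule del)
        show "distinct ?zs" using vs(1) x(2) ys ysD by auto
        show "set ?zs \<subseteq> fst G" using x(1) ysD vsG set_take_subset[of i vs] by auto
        show "real (length ?zs) \<le> H" using ord[OF step.hyps(2)] step.hyps(2) by (simp add: lys H_def)
      qed simp
      moreover have "(\<lambda>A. has_edge G (A - set ?zs)) = (\<lambda>A. has_edge ?D (A - insert ?x (neighbors ?D ?x)))"
      proof
        fix A
        have "A - set ?zs = A - insert ?x (neighbors ?D ?x) - set (take i vs)" by (auto simp: ys(1)[symmetric])
        then show "has_edge G (A - set ?zs) = has_edge ?D (A - insert ?x (neighbors ?D ?x))"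
          by (simp only: has_edge_del_vertices[OF G])
      qed
      moreover have "length ?zs = Suc (i + degree ?D ?x)" using step.hyps(2) by (simp add: lys)
      ultimately have l: "i + degree ?D ?x \<le> N"
        and b: "pd_le k V (N - (i + degree ?D ?x)) (\<lambda>A. has_edge ?D (A - insert ?x (neighbors ?D ?x)))"
        by auto
      have "(\<lambda>A. has_edge G (A - set (take (Suc i) vs))) = (\<lambda>A. has_edge ?D (A - {?x}))"
      proof
        fix A
        have "A - set (take (Suc i) vs) = A - {?x} - set (take i vs)"
          using step.hyps(2) by (auto simp: take_Suc_conv_app_nth)
        then show "has_edge G (A - set (take (Suc i) vs)) = has_edge ?D (A - {?x})"
          by (simp only: has_edge_del_vertices[OF G])
      qed
      with step.IH have a: "pd_le k V (N - Suc i) (\<lambda>A. has_edge ?D (A - {?x}))" by simp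
      have "pd_le k V (N - i) (has_edge ?D)"
      proof (rule pd_le_has_edge_step[OF sD _ _ a b])
        show "fst ?D \<subseteq> V" using less.prems(2) fD by blast
        show "?x \<in> fst ?D" using x by (simp add: fD)
        \<comment> \<open>The subtraction is exact because \<open>i < length vs\<close> and
          \<open>length vs \<le> N\<close>.\<close>
        show "Suc (N - Suc i) \<le> N - i" using base0 step.hyps(2) by linarith
        show "N - (i + degree ?D ?x) + degree ?D ?x \<le> N - i" using l by linarith
      qed
      moreover have "has_edge ?D = (\<lambda>A. has_edge G (A - set (take i vs)))"
        by (rule ext) (rule has_edge_del_vertices[OF G])
      ultimately show ?case by simp
    qed
    from this[of 0] have "pd_le k V N (has_edge G)" by simp
    moreover have "real N \<le> real n * (1 - 1 / H)" using nonneg by (simp add: N_def)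
    ultimately show ?thesis unfolding n_def H_def by blast
  qed
qed

theorem theorem3p3:
  fixes \<C> :: "'a graph set" and h :: "'a graph \<Rightarrow> real" and k :: "'k::field itself"
  assumes hered: "hereditary \<C>"
    and mono: "\<And>G v. G \<in> \<C> \<Longrightarrow> v \<in> fst G \<Longrightarrow> h (del_vertex G v) \<le> h G"
    and order: "\<And>G. G \<in> \<C> \<Longrightarrow> fst G \<noteq> {} \<Longrightarrow> \<exists>v\<in>fst G. \<exists>vs. distinct vs \<and> set vs = neighbors G v \<and>
          (\<forall>i < length vs. real i + real (degree (del_vertices G (take i vs)) (vs ! i)) + 1 \<le> h G) \<and>
          real (length vs) + 1 \<le> h G"
    and G: "G \<in> \<C>"
  shows "real (pd k G) \<le> real (card (fst G)) * (1 - 1 / h G)"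
proof -
  \<comment> \<open>With the vertex set of \<open>G\<close> as ambient set, the ring is the one in
    the definition of \<open>pd\<close>.\<close>
  obtain n where n: "real n \<le> real (card (fst G)) * (1 - 1 / h G)" "pd_le k (fst G) n (has_edge G)"
    using pd_le_hereditary[where h = h, OF hered mono order G order_refl] by blast
  moreover have "finite_simple_graph G" using hered G by (auto simp: hereditary_def)
  ultimately show ?thesis using pd_le_imp_pd[of G k n] by linarith
qed

end
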